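(* Every rational map of degree two with real coefficients and with real critical points (in $\mathbb R\cup\{\infty\}$) is conjugate, under an orientation preserving change of coordinates, to one and only one map in the canonical form $$ f(x)=\frac{A\,x^2+B}{C\,x^2+D}\quad\text{satisfying}\quad A^2+C^2=B^2+D^2\quad\text{and}\quad AD-BC>0,$$ with $A,B,C,D\in\mathbb R$. Here $A,B,C,D$ are uniquely determined up to multiplication by a common non-zero constant.
   Context: An orientation preserving change of coordinates is conjugation $f\mapsto L\circ f\circ L^{-1}$ by a real fractional linear transformation $L(x)=(ax+b)/(cx+d)$ with $ad-bc>0$. *)

theory Defs
  imports "HOL-Analysis.Analysis" "HOL-Computational_Algebra.Computational_Algebra"
begin

text \<open>
  The Riemann sphere is the type \<open>complex option\<close>, with \<open>None\<close> as the point at infinity.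
\<close>

type_synonym sphere = "complex option"

definition extended_reals :: "sphere set" where
  "extended_reals = insert None (Some ` \<real>)"

text \<open>
  The map \<open>p/q\<close> on the sphere. The value at infinity is the limit of \<open>p(z)/q(z)\<close>, that is, the
  quotient of the coefficients in degree \<open>max (degree p) (degree q)\<close>. The definition is meant
  for coprime \<open>p\<close> and \<open>q\<close>, and then a common zero never occurs.
\<close>

definition rat_map :: "real poly \<Rightarrow> real poly \<Rightarrow> sphere \<Rightarrow> sphere" where
  "rat_map p q w =
    (let P = map_poly complex_of_real p;
         Q = map_poly complex_of_real q;
         d = max (degree p) (degree q);
         (u, v) = (case w of Some z \<Rightarrow> (poly P z, poly Q z) | None \<Rightarrow> (coeff P d, coeff Q d))
     in if v = 0 then None else Some (u / v))"

definition real_rational_map :: "nat \<Rightarrow> (sphere \<Rightarrow> sphere) \<Rightarrow> bool" where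
  "real_rational_map n f \<longleftrightarrow>
    (\<exists>p q. coprime p q \<and> max (degree p) (degree q) = n \<and> f = rat_map p q)"

text \<open>
  Local coordinates at a point of the sphere, centred at that point: \<open>w - a\<close> at a finite point
  \<open>a\<close> and \<open>1/w\<close> at infinity. \<open>chart_inv w\<close> is the inverse of \<open>chart w\<close>. Outside its domain
  (\<open>None\<close> for the chart at a finite point, \<open>Some 0\<close> for the chart at infinity)
  \<open>chart\<close> has the dummy value 0; this lies away from the centre, so it does not affect derivatives
  of continuous maps there.
\<close>

fun chart :: "sphere \<Rightarrow> sphere \<Rightarrow> complex" where
  "chart (Some a) (Some w) = w - a"
| "chart (Some a) None = 0"
| "chart None (Some w) = 1 / w"
| "chart None None = 0"

fun chart_inv :: "sphere \<Rightarrow> complex \<Rightarrow> sphere" where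
  "chart_inv (Some a) t = Some (a + t)"
| "chart_inv None t = (if t = 0 then None else Some (1 / t))"

definition critical_point :: "(sphere \<Rightarrow> sphere) \<Rightarrow> sphere \<Rightarrow> bool" where
  "critical_point f w \<longleftrightarrow>
    ((\<lambda>t. chart (f w) (f (chart_inv w t))) has_field_derivative 0) (at 0)"

definition orientation_preserving_flt :: "(sphere \<Rightarrow> sphere) \<Rightarrow> bool" where
  "orientation_preserving_flt L \<longleftrightarrow>
    (\<exists>a b c d. a * d - b * c > 0 \<and> L = rat_map [:b, a:] [:d, c:])"

definition op_conjugate :: "(sphere \<Rightarrow> sphere) \<Rightarrow> (sphere \<Rightarrow> sphere) \<Rightarrow> bool" where
  "op_conjugate f g \<longleftrightarrow> (\<exists>L. orientation_preserving_flt L \<and> g = L \<circ> f \<circ> inv L)"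

definition canonical_form ::
  "real \<Rightarrow> real \<Rightarrow> real \<Rightarrow> real \<Rightarrow> (sphere \<Rightarrow> sphere) \<Rightarrow> bool" where
  "canonical_form A B C D g \<longleftrightarrow>
    g = rat_map [:B, 0, A:] [:D, 0, C:] \<and> A\<^sup>2 + C\<^sup>2 = B\<^sup>2 + D\<^sup>2 \<and> A * D - B * C > 0"

end

(*
  The critical points of p/q are the zeros of the Wronskian p'q - pq', a quadratic form whose
  discriminant is nonzero because p and q are coprime; if the critical points are real, it is
  positive, so there are two of them. Moving them to infinity and 0 gives a map
  (A x^2 + B) / (C x^2 + D). The remaining freedom consists of x -> k x and x -> -k/x with k > 0.
  The second kind reverses the sign of AD - BC, and under the first kind the balance
  A^2 + C^2 = B^2 + D^2 becomes an equation in k with exactly one positive solution.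
  For uniqueness, 0 and infinity are recognised as the only points that are alone in their fibre,
  so that a conjugation between two canonical maps permutes them.
*)

theory Submission
  imports Defs
begin

section \<open>Homogeneous coordinates\<close>

text \<open>The point with homogeneous coordinates \<open>[u : v]\<close>. Identities between maps
  become polynomial identities in \<open>u\<close> and \<open>v\<close> that treat infinity like any
  other point. The pair \<open>(0, 0)\<close> represents no point and gets the dummy value
  \<open>None\<close>.\<close>

definition proj_point :: "complex \<Rightarrow> complex \<Rightarrow> sphere" where
  "proj_point u v = (if v = 0 then None else Some (u / v))"

lemma proj_point_cases:
  obtains u v where "u \<noteq> 0 \<or> v \<noteq> 0" "w = proj_point u v"
proof (cases w)
  case None
  then show ?thesis using that[of 1 0] by (simp add: proj_point_def)
next
  case (Some z)
  then show ?thesis using that[of z 1] by (simp add: proj_point_def)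
qed

lemma proj_point_eq_iff:
  assumes "u \<noteq> 0 \<or> v \<noteq> 0" "u' \<noteq> 0 \<or> v' \<noteq> 0"
  shows "proj_point u v = proj_point u' v' \<longleftrightarrow> u * v' = u' * v"
  using assms by (auto simp: proj_point_def field_simps)

abbreviation moebius :: "real \<Rightarrow> real \<Rightarrow> real \<Rightarrow> real \<Rightarrow> sphere \<Rightarrow> sphere" where
  "moebius a b c d \<equiv> rat_map [:b, a:] [:d, c:]"

abbreviation even_quadratic :: "real \<Rightarrow> real \<Rightarrow> real \<Rightarrow> real \<Rightarrow> sphere \<Rightarrow> sphere" where
  "even_quadratic A B C D \<equiv> rat_map [:B, 0, A:] [:D, 0, C:]"

lemma moebius_proj_point:
  assumes "a * d - b * c \<noteq> 0" "u \<noteq> 0 \<or> v \<noteq> 0"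
  shows "moebius a b c d (proj_point u v) = proj_point (a * u + b * v) (c * u + d * v)"
proof (cases "v = 0")
  case True
  \<comment> \<open>The determinant excludes \<open>a = c = 0\<close>, so at infinity
    \<open>rat_map\<close> reads off the coefficients of degree 1.\<close>
  have "max (degree [:b, a:]) (degree [:d, c:]) = 1"
    using assms(1) by auto
  then show ?thesis
    using True assms by (auto simp: proj_point_def rat_map_def map_poly_pCons)
next
  case False
  have *: "b + (u / v) * a = (a * u + b * v) / v" "d + (u / v) * c = (c * u + d * v) / v"
    using False by (simp_all add: field_simps)
  have "moebius a b c d (proj_point u v) =
    (if d + (u / v) * c = 0 then None else Some ((b + (u / v) * a) / (d + (u / v) * c)))"
    using False by (simp add: proj_point_def rat_map_def map_poly_pCons)
  then show ?thesis
    unfolding * using False by (simp add: proj_point_def)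
qed

lemma quadratic_proj_point:
  assumes "p2 \<noteq> 0 \<or> q2 \<noteq> 0" "u \<noteq> 0 \<or> v \<noteq> 0"
  shows "rat_map [:p0, p1, p2:] [:q0, q1, q2:] (proj_point u v) =
    proj_point (p2 * u\<^sup>2 + p1 * u * v + p0 * v\<^sup>2) (q2 * u\<^sup>2 + q1 * u * v + q0 * v\<^sup>2)"
proof (cases "v = 0")
  case True
  have "max (degree [:p0, p1, p2:]) (degree [:q0, q1, q2:]) = 2"
    using assms(1) by auto
  then show ?thesis
    using True assms by (auto simp: proj_point_def rat_map_def map_poly_pCons numeral_2_eq_2)
next
  case False
  have *: "p0 + (u / v) * (p1 + (u / v) * p2) = (p2 * u\<^sup>2 + p1 * u * v + p0 * v\<^sup>2) / v\<^sup>2"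
    "q0 + (u / v) * (q1 + (u / v) * q2) = (q2 * u\<^sup>2 + q1 * u * v + q0 * v\<^sup>2) / v\<^sup>2"
    using False by (simp_all add: field_simps power2_eq_square)
  have "rat_map [:p0, p1, p2:] [:q0, q1, q2:] (proj_point u v) =
    (if q0 + (u / v) * (q1 + (u / v) * q2) = 0 then None
     else Some ((p0 + (u / v) * (p1 + (u / v) * p2)) / (q0 + (u / v) * (q1 + (u / v) * q2))))"
    using False by (simp add: proj_point_def rat_map_def map_poly_pCons)
  then show ?thesis
    unfolding * using False by (simp add: proj_point_def)
qed

text \<open>Cramer's rule: the adjugate matrix recovers the determinant times \<open>u\<close> and
  times \<open>v\<close> from the two linear forms.\<close>

lemma linear_pair_nonzero:
  fixes a b c d :: real and u v :: complex
  assumes "a * d - b * c \<noteq> 0" "u \<noteq> 0 \<or> v \<noteq> 0"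
  shows "a * u + b * v \<noteq> 0 \<or> c * u + d * v \<noteq> 0"
proof (rule ccontr)
  assume "\<not> ?thesis"
  then have 0: "a * u + b * v = 0" "c * u + d * v = 0" by auto
  have "of_real (a * d - b * c) * u = d * (a * u + b * v) - b * (c * u + d * v)"
    "of_real (a * d - b * c) * v = a * (c * u + d * v) - c * (a * u + b * v)"
    by (simp_all add: algebra_simps)
  then have "of_real (a * d - b * c) * u = 0" "of_real (a * d - b * c) * v = 0"
    unfolding 0 by simp_all
  moreover have "complex_of_real (a * d - b * c) \<noteq> 0"
    unfolding of_real_eq_0_iff by (rule assms(1))
  ultimately show False using assms(2) unfolding mult_eq_0_iff by blast
qed

section \<open>Fractional linear transformations and conjugacy\<close>

lemma moebius_comp:
  assumes "a * d - b * c \<noteq> 0" "a' * d' - b' * c' \<noteq> 0"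
  shows "moebius a b c d \<circ> moebius a' b' c' d' =
    moebius (a * a' + b * c') (a * b' + b * d') (c * a' + d * c') (c * b' + d * d')"
proof
  fix w
  obtain u v where w: "u \<noteq> 0 \<or> v \<noteq> 0" "w = proj_point u v"
    by (rule proj_point_cases)
  have "(a * a' + b * c') * (c * b' + d * d') - (a * b' + b * d') * (c * a' + d * c') =
    (a * d - b * c) * (a' * d' - b' * c')"
    by (simp add: algebra_simps)
  then have det: "(a * a' + b * c') * (c * b' + d * d') - (a * b' + b * d') * (c * a' + d * c') \<noteq> 0"
    using assms by simp
  show "(moebius a b c d \<circ> moebius a' b' c' d') w =
    moebius (a * a' + b * c') (a * b' + b * d') (c * a' + d * c') (c * b' + d * d') w"
    unfolding w o_apply moebius_proj_point[OF assms(2) w(1)] moebius_proj_point[OF det w(1)]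
      moebius_proj_point[OF assms(1) linear_pair_nonzero[OF assms(2) w(1)]]
    by (simp add: algebra_simps)
qed

lemma moebius_scalar: "a \<noteq> 0 \<Longrightarrow> moebius a 0 0 a = id"
proof
  fix w assume "a \<noteq> 0"
  obtain u v where w: "u \<noteq> 0 \<or> v \<noteq> 0" "w = proj_point u v"
    by (rule proj_point_cases)
  have det: "a * a - 0 * 0 \<noteq> 0" using \<open>a \<noteq> 0\<close> by simp
  show "moebius a 0 0 a w = id w"
    unfolding w moebius_proj_point[OF det w(1)] using \<open>a \<noteq> 0\<close> by (simp add: proj_point_def)
qed

text \<open>The adjugate represents the inverse: both matrix products are the determinant times the
  identity, and scalar matrices act trivially.\<close>

lemma moebius_inverse:
  assumes "a * d - b * c \<noteq> 0"
  shows "moebius a b c d \<circ> moebius d (-b) (-c) a = id" "moebius d (-b) (-c) a \<circ> moebius a b c d = id"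
proof -
  have *: "a * d - c * b \<noteq> 0" "d * a - b * c \<noteq> 0" "d * a - c * b \<noteq> 0"
    using assms by (simp_all add: mult.commute)
  show "moebius a b c d \<circ> moebius d (-b) (-c) a = id" "moebius d (-b) (-c) a \<circ> moebius a b c d = id"
    using assms * moebius_scalar[OF assms]
    by (simp_all add: moebius_comp mult.commute)
qed

lemma bij_moebius:
  assumes "a * d - b * c \<noteq> 0"
  shows "bij (moebius a b c d)"
  using moebius_inverse[OF assms] o_bij by blast

lemma surj_comp_cancel: "surj h \<Longrightarrow> f \<circ> h = g \<circ> h \<Longrightarrow> f = g"
  by (metis comp_apply ext surjD)

text \<open>Removes \<open>inv\<close>: since \<open>L\<close> is bijective, conjugacy becomes a
  commutation relation with an explicit matrix, which can be checked in homogeneous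
  coordinates.\<close>

lemma op_conjugate_iff:
  "op_conjugate f g \<longleftrightarrow> (\<exists>a b c d. a * d - b * c > 0 \<and> g \<circ> moebius a b c d = moebius a b c d \<circ> f)"
proof -
  have "g = L \<circ> f \<circ> inv L \<longleftrightarrow> g \<circ> L = L \<circ> f" if "bij L" for L
    using that by (metis bij_is_inj bij_is_surj comp_assoc comp_id inv_o_cancel surj_iff)
  then show ?thesis
    unfolding op_conjugate_def orientation_preserving_flt_def
    using bij_moebius by (metis less_irrefl)
qed

lemma op_conjugate_trans:
  assumes "op_conjugate f g" "op_conjugate g h"
  shows "op_conjugate f h"
proof -
  obtain a b c d where 1: "a * d - b * c > 0" "g \<circ> moebius a b c d = moebius a b c d \<circ> f"
    using assms(1) op_conjugate_iff by blast
  obtain a' b' c' d' where 2: "a' * d' - b' * c' > 0" "h \<circ> moebius a' b' c' d' = moebius a' b' c' d' \<circ> g"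
    using assms(2) op_conjugate_iff by blast
  let ?L = "moebius a' b' c' d' \<circ> moebius a b c d"
  have eq: "h \<circ> ?L = ?L \<circ> f"
    using fun_cong[OF 1(2)] fun_cong[OF 2(2)] by (simp add: fun_eq_iff)
  have "(a' * a + b' * c) * (c' * b + d' * d) - (a' * b + b' * d) * (c' * a + d' * c) =
    (a' * d' - b' * c') * (a * d - b * c)"
    by (simp add: algebra_simps)
  then have "(a' * a + b' * c) * (c' * b + d' * d) - (a' * b + b' * d) * (c' * a + d' * c) > 0"
    using 1 2 by simp
  moreover have "?L = moebius (a' * a + b' * c) (a' * b + b' * d) (c' * a + d' * c) (c' * b + d' * d)"
    using 1 2 by (intro moebius_comp) auto
  ultimately show ?thesis
    unfolding op_conjugate_iff using eq by auto
qed

lemma op_conjugate_sym: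
  assumes "op_conjugate f g"
  shows "op_conjugate g f"
proof -
  obtain a b c d where 1: "a * d - b * c > 0" "g \<circ> moebius a b c d = moebius a b c d \<circ> f"
    using assms op_conjugate_iff by blast
  then have "a * d - b * c \<noteq> 0" by simp
  note inv = moebius_inverse[OF this]
  have "f \<circ> moebius d (-b) (-c) a =
      moebius d (-b) (-c) a \<circ> (moebius a b c d \<circ> f) \<circ> moebius d (-b) (-c) a"
    unfolding comp_assoc[symmetric] inv by simp
  also have "\<dots> = moebius d (-b) (-c) a \<circ> g"
    unfolding 1(2)[symmetric] unfolding comp_assoc inv by simp
  finally have "f \<circ> moebius d (-b) (-c) a = moebius d (-b) (-c) a \<circ> g" .
  moreover have "d * a - (-b) * (-c) > 0" using 1 by (simp add: mult.commute)
  ultimately show ?thesis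
    using op_conjugate_iff by blast
qed

section \<open>Maps with critical points 0 and infinity\<close>

lemma even_quadratic_proj_point:
  assumes "A * D - B * C \<noteq> 0" "u \<noteq> 0 \<or> v \<noteq> 0"
  shows "even_quadratic A B C D (proj_point u v) = proj_point (A * u\<^sup>2 + B * v\<^sup>2) (C * u\<^sup>2 + D * v\<^sup>2)"
  using assms by (subst quadratic_proj_point) auto

text \<open>The map is squaring followed by the matrix with rows \<open>A, B\<close> and
  \<open>C, D\<close>, so the linear case applies to the pair of squares.\<close>

lemma even_quadratic_pair_nonzero:
  fixes A B C D :: real and u v :: complex
  assumes "A * D - B * C \<noteq> 0" "u \<noteq> 0 \<or> v \<noteq> 0"
  shows "A * u\<^sup>2 + B * v\<^sup>2 \<noteq> 0 \<or> C * u\<^sup>2 + D * v\<^sup>2 \<noteq> 0"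
  using assms by (intro linear_pair_nonzero) auto

lemma even_quadratic_proj_point_eq_iff:
  assumes "A * D - B * C \<noteq> 0" "A' * D' - B' * C' \<noteq> 0" "u \<noteq> 0 \<or> v \<noteq> 0" "u' \<noteq> 0 \<or> v' \<noteq> 0"
  shows "even_quadratic A B C D (proj_point u v) = even_quadratic A' B' C' D' (proj_point u' v') \<longleftrightarrow>
    (A * u\<^sup>2 + B * v\<^sup>2) * (C' * u'\<^sup>2 + D' * v'\<^sup>2) = (A' * u'\<^sup>2 + B' * v'\<^sup>2) * (C * u\<^sup>2 + D * v\<^sup>2)"
  unfolding even_quadratic_proj_point[OF assms(1,3)] even_quadratic_proj_point[OF assms(2,4)]
  by (rule proj_point_eq_iff[OF even_quadratic_pair_nonzero[OF assms(1,3)]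
        even_quadratic_pair_nonzero[OF assms(2,4)]])

lemma even_quadratic_scale:
  assumes "k \<noteq> 0" "A * D - B * C \<noteq> 0"
  shows "even_quadratic (k * A) (k * B) (k * C) (k * D) = even_quadratic A B C D"
proof
  fix w
  obtain u v where w: "u \<noteq> 0 \<or> v \<noteq> 0" "w = proj_point u v"
    by (rule proj_point_cases)
  have "(k * A) * (k * D) - (k * B) * (k * C) = k\<^sup>2 * (A * D - B * C)"
    by (simp add: algebra_simps power2_eq_square)
  then have det: "(k * A) * (k * D) - (k * B) * (k * C) \<noteq> 0" using assms by simp
  show "even_quadratic (k * A) (k * B) (k * C) (k * D) w = even_quadratic A B C D w"
    unfolding w even_quadratic_proj_point_eq_iff[OF det assms(2) w(1) w(1)]
    by (simp add: algebra_simps)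
qed

lemma even_quadratic_eqD:
  assumes det: "A * D - B * C \<noteq> 0" "A' * D' - B' * C' \<noteq> 0"
    and eq: "even_quadratic A B C D = even_quadratic A' B' C' D'"
  obtains k where "k \<noteq> 0" "A' = k * A" "B' = k * B" "C' = k * C" "D' = k * D"
proof -
  have cross: "(A * u\<^sup>2 + B * v\<^sup>2) * (C' * u\<^sup>2 + D' * v\<^sup>2) = (A' * u\<^sup>2 + B' * v\<^sup>2) * (C * u\<^sup>2 + D * v\<^sup>2)"
    if "u \<noteq> 0 \<or> v \<noteq> 0" for u v :: real
  proof -
    have nz: "complex_of_real u \<noteq> 0 \<or> complex_of_real v \<noteq> 0" using that by simp
    show ?thesis
      using even_quadratic_proj_point_eq_iff[OF det nz nz, unfolded eq, THEN iffD1, OF refl]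
      unfolding of_real_mult[symmetric] of_real_add[symmetric] of_real_power[symmetric] of_real_eq_iff .
  qed
  \<comment> \<open>The points \<open>[1 : 0]\<close>, \<open>[0 : 1]\<close> and
    \<open>[1 : 1]\<close> yield the coefficients of \<open>u^4\<close>, \<open>v^4\<close> and
    \<open>u^2 v^2\<close> in \<open>cross\<close>.\<close>
  have 1: "A * C' = A' * C" using cross[of 1 0] by simp
  have 2: "B * D' = B' * D" using cross[of 0 1] by simp
  have 3: "A * D' + B * C' = A' * D + B' * C" using cross[of 1 1] 1 2 by (simp add: algebra_simps)
  define E where "E = A * D - B * C"
  \<comment> \<open>If the primed coefficients are \<open>k\<close> times the others, then
    \<open>A' * D - B * C'\<close> and \<open>A * D' - B' * C\<close> both equal
    \<open>k * E\<close>. Relation 3 says that these two expressions agree.\<close>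
  define k where "k = (A' * D - B * C') / E"
  have E: "E \<noteq> 0" using det by (simp add: E_def)
  have kE: "k * E = A' * D - B * C'" using E by (simp add: k_def)
  have kE': "k * E = A * D' - B' * C" using kE 3 by simp
  have "E * A' - A * (A' * D - B * C') = B * (A * C' - A' * C)"
    "E * C' - C * (A' * D - B * C') = D * (A * C' - A' * C)"
    "E * B' - B * (A * D' - B' * C) = A * (B' * D - B * D')"
    "E * D' - D * (A * D' - B' * C) = C * (B' * D - B * D')"
    by (simp_all add: E_def algebra_simps)
  then have "E * A' = A * (k * E)" "E * C' = C * (k * E)" "E * B' = B * (k * E)" "E * D' = D * (k * E)"
    unfolding 1 2 kE[symmetric] kE'[symmetric] by simp_all
  then have *: "A' = k * A" "B' = k * B" "C' = k * C" "D' = k * D"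
    using E by simp_all
  moreover have "k \<noteq> 0" using * det(2) by auto
  ultimately show ?thesis using that by blast
qed

text \<open>The new coefficients come from \<open>k f(x/k)\<close>, with numerator and denominator
  multiplied by \<open>k^2\<close>.\<close>

lemma even_quadratic_conj_scaling:
  assumes "A * D - B * C \<noteq> 0" "k \<noteq> 0"
  shows "even_quadratic (k * A) (k ^ 3 * B) C (k\<^sup>2 * D) \<circ> moebius k 0 0 1 =
    moebius k 0 0 1 \<circ> even_quadratic A B C D"
proof
  fix w
  obtain u v where w: "u \<noteq> 0 \<or> v \<noteq> 0" "w = proj_point u v"
    by (rule proj_point_cases)
  have "(k * A) * (k\<^sup>2 * D) - (k ^ 3 * B) * C = k ^ 3 * (A * D - B * C)"
    by (simp add: algebra_simps power2_eq_square power3_eq_cube)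
  then have det: "(k * A) * (k\<^sup>2 * D) - (k ^ 3 * B) * C \<noteq> 0" using assms by simp
  have m: "k * 1 - 0 * 0 \<noteq> 0" using assms by simp
  note q = even_quadratic_pair_nonzero[OF assms(1) w(1)]
  note l = linear_pair_nonzero[OF m w(1)]
  show "(even_quadratic (k * A) (k ^ 3 * B) C (k\<^sup>2 * D) \<circ> moebius k 0 0 1) w =
    (moebius k 0 0 1 \<circ> even_quadratic A B C D) w"
    unfolding w o_apply even_quadratic_proj_point[OF assms(1) w(1)] moebius_proj_point[OF m w(1)]
      even_quadratic_proj_point[OF det l] moebius_proj_point[OF m q]
    by (subst proj_point_eq_iff[OF even_quadratic_pair_nonzero[OF det l] linear_pair_nonzero[OF m q]])
      (simp add: algebra_simps power2_eq_square power3_eq_cube)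
qed

text \<open>The map \<open>x -> -k/x\<close> is its own inverse. The coefficients come from
  \<open>-k / f(-k/x)\<close>, with numerator and denominator multiplied by
  \<open>x^2\<close>.\<close>

lemma even_quadratic_conj_inversion:
  assumes "A * D - B * C \<noteq> 0" "k \<noteq> 0"
  shows "even_quadratic (- k * D) (- (k ^ 3) * C) B (k\<^sup>2 * A) \<circ> moebius 0 (- k) 1 0 =
    moebius 0 (- k) 1 0 \<circ> even_quadratic A B C D"
proof
  fix w
  obtain u v where w: "u \<noteq> 0 \<or> v \<noteq> 0" "w = proj_point u v"
    by (rule proj_point_cases)
  have "(- k * D) * (k\<^sup>2 * A) - (- (k ^ 3) * C) * B = - (k ^ 3) * (A * D - B * C)"
    by (simp add: algebra_simps power2_eq_square power3_eq_cube)
  then have det: "(- k * D) * (k\<^sup>2 * A) - (- (k ^ 3) * C) * B \<noteq> 0" using assms by simp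
  have m: "0 * 0 - (- k) * 1 \<noteq> 0" using assms by simp
  note q = even_quadratic_pair_nonzero[OF assms(1) w(1)]
  note l = linear_pair_nonzero[OF m w(1)]
  show "(even_quadratic (- k * D) (- (k ^ 3) * C) B (k\<^sup>2 * A) \<circ> moebius 0 (- k) 1 0) w =
    (moebius 0 (- k) 1 0 \<circ> even_quadratic A B C D) w"
    unfolding w o_apply even_quadratic_proj_point[OF assms(1) w(1)] moebius_proj_point[OF m w(1)]
      even_quadratic_proj_point[OF det l] moebius_proj_point[OF m q]
    by (subst proj_point_eq_iff[OF even_quadratic_pair_nonzero[OF det l] linear_pair_nonzero[OF m q]])
      (simp add: algebra_simps power2_eq_square power3_eq_cube)
qed

text \<open>The matrix of coefficients is invertible, so two points have the same image iff their
  squares agree. The fibre of \<open>w\<close> thus consists of \<open>w\<close> and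
  \<open>-w\<close>. This describes 0 and infinity by a property that every bijective conjugation
  preserves, without derivatives.\<close>

lemma even_quadratic_singleton_fibre:
  assumes "A * D - B * C \<noteq> 0"
  shows "(\<forall>w'. even_quadratic A B C D w' = even_quadratic A B C D w \<longrightarrow> w' = w)
    \<longleftrightarrow> w = None \<or> w = Some 0"
proof -
  obtain u v where w: "u \<noteq> 0 \<or> v \<noteq> 0" "w = proj_point u v"
    by (rule proj_point_cases)
  have iff: "even_quadratic A B C D (proj_point u' v') = even_quadratic A B C D w \<longleftrightarrow>
      u'\<^sup>2 * v\<^sup>2 = u\<^sup>2 * v'\<^sup>2" if "u' \<noteq> 0 \<or> v' \<noteq> 0" for u' v'
  proof -
    have "even_quadratic A B C D (proj_point u' v') = even_quadratic A B C D w \<longleftrightarrow>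
      (A * u'\<^sup>2 + B * v'\<^sup>2) * (C * u\<^sup>2 + D * v\<^sup>2) = (A * u\<^sup>2 + B * v\<^sup>2) * (C * u'\<^sup>2 + D * v'\<^sup>2)"
      unfolding w by (rule even_quadratic_proj_point_eq_iff[OF assms assms that w(1)])
    also have "\<dots> \<longleftrightarrow> of_real (A * D - B * C) * (u'\<^sup>2 * v\<^sup>2 - u\<^sup>2 * v'\<^sup>2) = (0::complex)"
      by (simp add: algebra_simps)
    also have "\<dots> \<longleftrightarrow> u'\<^sup>2 * v\<^sup>2 = u\<^sup>2 * v'\<^sup>2"
      using assms by (simp del: of_real_diff of_real_mult)
    finally show ?thesis .
  qed
  show ?thesis
  proof
    assume fib: "\<forall>w'. even_quadratic A B C D w' = even_quadratic A B C D w \<longrightarrow> w' = w"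
    have "proj_point (- u) v = w" using fib iff[of "- u" v] w(1) by auto
    then have "- u * v = u * v" using w proj_point_eq_iff[of "- u" v u v] by auto
    then have "u = 0 \<or> v = 0" by (simp add: eq_neg_iff_add_eq_0)
    then show "w = None \<or> w = Some 0" using w by (auto simp: proj_point_def)
  next
    assume a: "w = None \<or> w = Some 0"
    then have uv: "u = 0 \<or> v = 0" using w by (auto simp: proj_point_def split: if_splits)
    show "\<forall>w'. even_quadratic A B C D w' = even_quadratic A B C D w \<longrightarrow> w' = w"
    proof (intro allI impI)
      fix w' assume e: "even_quadratic A B C D w' = even_quadratic A B C D w"
      obtain u' v' where w': "u' \<noteq> 0 \<or> v' \<noteq> 0" "w' = proj_point u' v'"
        by (rule proj_point_cases)
      have "u'\<^sup>2 * v\<^sup>2 = u\<^sup>2 * v'\<^sup>2" using e iff w' by simp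
      then have "u' * v = u * v'" using uv by auto
      then show "w' = w" using w w' proj_point_eq_iff by simp
    qed
  qed
qed

section \<open>The balance condition under scaling\<close>

text \<open>In terms of \<open>t = k^2\<close> the balance after scaling is a cubic equation.
  Balance before scaling makes \<open>t = 1\<close> a root, and the cofactor of \<open>t - 1\<close>
  is positive for \<open>t > 0\<close>.\<close>

lemma balanced_scaling_trivial:
  fixes A B C D k :: real
  assumes "k > 0" "A\<^sup>2 + C\<^sup>2 > 0" "A\<^sup>2 + C\<^sup>2 = B\<^sup>2 + D\<^sup>2"
    and eq: "(k * A)\<^sup>2 + C\<^sup>2 = (k ^ 3 * B)\<^sup>2 + (k\<^sup>2 * D)\<^sup>2"
  shows "k = 1"
proof -
  define t where "t = k\<^sup>2"
  have t: "t > 0" using assms by (simp add: t_def)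
  have eq': "t * A\<^sup>2 + C\<^sup>2 = t ^ 3 * B\<^sup>2 + t\<^sup>2 * D\<^sup>2"
    using eq by (simp add: t_def power_mult_distrib flip: power_mult)
  have "(t - 1) * ((t\<^sup>2 + t) * B\<^sup>2 + t * D\<^sup>2 + C\<^sup>2) =
    (t ^ 3 * B\<^sup>2 + t\<^sup>2 * D\<^sup>2) - (t * A\<^sup>2 + C\<^sup>2) + t * (A\<^sup>2 + C\<^sup>2 - B\<^sup>2 - D\<^sup>2)"
    by (simp add: algebra_simps power2_eq_square power3_eq_cube)
  then have prod: "(t - 1) * ((t\<^sup>2 + t) * B\<^sup>2 + t * D\<^sup>2 + C\<^sup>2) = 0"
    using eq' assms(3) by simp
  have "B \<noteq> 0 \<or> D \<noteq> 0" using assms by auto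
  then have "(t\<^sup>2 + t) * B\<^sup>2 > 0 \<or> t * D\<^sup>2 > 0"
    using t by (auto intro!: mult_pos_pos add_pos_pos)
  moreover have "(t\<^sup>2 + t) * B\<^sup>2 \<ge> 0" "t * D\<^sup>2 \<ge> 0" "C\<^sup>2 \<ge> 0"
    using t by simp_all
  ultimately have "(t\<^sup>2 + t) * B\<^sup>2 + t * D\<^sup>2 + C\<^sup>2 \<noteq> 0"
    by linarith
  then have "t = 1" using prod by simp
  then show ?thesis using assms(1) by (simp add: t_def power2_eq_1_iff)
qed

text \<open>Intermediate value theorem for the cubic \<open>h\<close> in \<open>t = k^2\<close>. In
  the decomposition \<open>split\<close> the two summands change sign at \<open>r\<close> and at 1
  respectively, so \<open>h\<close> has a zero between these two positive numbers.\<close>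

lemma balanced_scaling_exists:
  fixes A B C D :: real
  assumes "A * D - B * C \<noteq> 0"
  obtains k where "k > 0" "(k * A)\<^sup>2 + C\<^sup>2 = (k ^ 3 * B)\<^sup>2 + (k\<^sup>2 * D)\<^sup>2"
proof -
  define h where "h t = t ^ 3 * B\<^sup>2 + t\<^sup>2 * D\<^sup>2 - t * A\<^sup>2 - C\<^sup>2" for t
  define r where "r = (A\<^sup>2 + C\<^sup>2) / (B\<^sup>2 + D\<^sup>2)"
  have pos: "B\<^sup>2 + D\<^sup>2 > 0" "A\<^sup>2 + C\<^sup>2 > 0"
    using assms by (auto simp: sum_power2_gt_zero_iff)
  then have r: "r > 0" by (simp add: r_def)
  have rr: "A\<^sup>2 + C\<^sup>2 = r * (B\<^sup>2 + D\<^sup>2)"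
    unfolding r_def times_divide_eq_left
    by (rule nonzero_mult_div_cancel_right[OF less_imp_neq[OF pos(1), symmetric], symmetric])
  have split: "h t = t * (t - r) * (B\<^sup>2 + D\<^sup>2) + (t - 1) * (t\<^sup>2 * B\<^sup>2 + C\<^sup>2)" for t
    using rr unfolding h_def by algebra
  define lo hi where "lo = min 1 r" and "hi = max 1 r"
  have "h lo \<le> 0"
    unfolding split using r pos
    by (intro add_nonpos_nonpos mult_nonpos_nonneg mult_nonneg_nonpos) (auto simp: lo_def)
  moreover have "h hi \<ge> 0"
    unfolding split using r pos
    by (intro add_nonneg_nonneg mult_nonneg_nonneg) (auto simp: hi_def)
  moreover have "lo \<le> hi" by (auto simp: lo_def hi_def)
  moreover have "continuous_on {lo..hi} h" unfolding h_def by (intro continuous_intros)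
  ultimately obtain t where t: "lo \<le> t" "h t = 0" using IVT'[of h lo 0 hi] by blast
  then have "t > 0" using r by (simp add: lo_def)
  then have "sqrt t > 0" "t = (sqrt t)\<^sup>2" by simp_all
  moreover define k where "k = sqrt t"
  ultimately have k: "k > 0" "t = k\<^sup>2" by simp_all
  have "(k * A)\<^sup>2 + C\<^sup>2 = (k ^ 3 * B)\<^sup>2 + (k\<^sup>2 * D)\<^sup>2"
    using t(2) unfolding h_def k(2) by (simp add: power_mult_distrib flip: power_mult)
  then show ?thesis using that k by blast
qed

section \<open>Uniqueness and existence of the canonical form for even quadratic maps\<close>

lemma op_conjugate_canonical_form_unique:
  assumes "canonical_form A B C D g" "canonical_form A' B' C' D' g'" "op_conjugate g g'"
  shows "g = g'"
proof -
  have g: "g = even_quadratic A B C D" "A\<^sup>2 + C\<^sup>2 = B\<^sup>2 + D\<^sup>2" "A * D - B * C > 0"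
    and g': "g' = even_quadratic A' B' C' D'" "A'\<^sup>2 + C'\<^sup>2 = B'\<^sup>2 + D'\<^sup>2" "A' * D' - B' * C' > 0"
    using assms by (auto simp: canonical_form_def)
  have det: "A * D - B * C \<noteq> 0" "A' * D' - B' * C' \<noteq> 0" using g g' by auto
  obtain a b c d where L: "a * d - b * c > 0" "g' \<circ> moebius a b c d = moebius a b c d \<circ> g"
    using assms(3) op_conjugate_iff by blast
  have Lnz: "a * d - b * c \<noteq> 0" using L by simp
  let ?L = "moebius a b c d"
  have bij: "bij ?L" by (rule bij_moebius[OF Lnz])
  then have surj: "surj ?L" by (rule bij_is_surj)
  have comm: "g' (?L w) = ?L (g w)" for w
    by (rule fun_cong[OF L(2), unfolded o_apply])
  \<comment> \<open>The conjugation carries one-point fibres of \<open>g\<close> to one-point fibres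
    of \<open>g'\<close>, so it maps the set of 0 and infinity into itself.\<close>
  have fib: "?L w = None \<or> ?L w = Some 0" if "w = None \<or> w = Some 0" for w
  proof -
    have *: "\<forall>w'. g w' = g w \<longrightarrow> w' = w"
      using that unfolding g(1) even_quadratic_singleton_fibre[OF det(1)] .
    have "\<forall>w'. g' w' = g' (?L w) \<longrightarrow> w' = ?L w"
    proof (intro allI impI)
      fix w' assume eq: "g' w' = g' (?L w)"
      obtain x where x: "w' = ?L x" using surj by (rule surjE)
      have "g x = g w" using eq unfolding x comm by (rule injD[OF bij_is_inj[OF bij]])
      then show "w' = ?L w" using * x by blast
    qed
    then show ?thesis unfolding g'(1) even_quadratic_singleton_fibre[OF det(2)] .
  qed
  have "?L None = proj_point a c" "?L (Some 0) = proj_point b d"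
    using moebius_proj_point[OF Lnz, of 1 0] moebius_proj_point[OF Lnz, of 0 1]
    by (simp_all add: proj_point_def)
  then have "a = 0 \<or> c = 0" "b = 0 \<or> d = 0"
    using fib[of None] fib[of "Some 0"] by (auto simp: proj_point_def split: if_splits)
  \<comment> \<open>A nonzero determinant rules out \<open>a = b = 0\<close> and
    \<open>c = d = 0\<close>, leaving diagonal and antidiagonal matrices.\<close>
  then consider "b = 0" "c = 0" | "a = 0" "d = 0" using Lnz by auto
  then show ?thesis
  proof cases
    case 1
    define k where "k = a / d"
    have ad: "a * d > 0" using L 1 by simp
    then have k: "k > 0" "d \<noteq> 0" by (auto simp: k_def zero_less_divide_iff zero_less_mult_iff)
    have "?L = moebius k 0 0 1 \<circ> moebius d 0 0 d"
      using 1 k by (subst moebius_comp) (auto simp: k_def)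
    then have Lk: "?L = moebius k 0 0 1" unfolding moebius_scalar[OF k(2)] comp_id .
    let ?h = "even_quadratic (k * A) (k ^ 3 * B) C (k\<^sup>2 * D)"
    have "g' \<circ> ?L = ?h \<circ> ?L"
      unfolding L(2) unfolding Lk g(1)
      using k by (intro even_quadratic_conj_scaling[OF det(1), symmetric]) simp
    then have "g' = ?h" by (rule surj_comp_cancel[OF surj])
    have "(k * A) * (k\<^sup>2 * D) - (k ^ 3 * B) * C = k ^ 3 * (A * D - B * C)"
      by (simp add: algebra_simps power2_eq_square power3_eq_cube)
    then have "(k * A) * (k\<^sup>2 * D) - (k ^ 3 * B) * C \<noteq> 0" using det k by simp
    then obtain m where m: "m \<noteq> 0" "k * A = m * A'" "k ^ 3 * B = m * B'" "C = m * C'" "k\<^sup>2 * D = m * D'"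
      by (rule even_quadratic_eqD[OF det(2) _ g'(1)[symmetric, THEN trans, OF \<open>g' = ?h\<close>]])
    \<comment> \<open>Balance is homogeneous in the coefficients, so it passes from the primed ones
      to their multiples by \<open>m\<close>.\<close>
    have "(k * A)\<^sup>2 + C\<^sup>2 = (k ^ 3 * B)\<^sup>2 + (k\<^sup>2 * D)\<^sup>2"
      unfolding m using g'(2) by (simp add: power_mult_distrib flip: distrib_left)
    moreover have "A\<^sup>2 + C\<^sup>2 > 0" using det(1) by (auto simp: sum_power2_gt_zero_iff)
    ultimately have "k = 1" using balanced_scaling_trivial k g(2) by blast
    then show ?thesis using \<open>g' = ?h\<close> g by simp
  next
    case 2
    define k where "k = - b / c"
    have "- (b * c) > 0" using L 2 by simp
    then have k: "k > 0" "c \<noteq> 0" by (auto simp: k_def zero_less_divide_iff mult_less_0_iff divide_less_0_iff)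
    have "?L = moebius 0 (- k) 1 0 \<circ> moebius c 0 0 c"
      using 2 k by (subst moebius_comp) (auto simp: k_def)
    then have Lk: "?L = moebius 0 (- k) 1 0" unfolding moebius_scalar[OF k(2)] comp_id .
    let ?h = "even_quadratic (- k * D) (- (k ^ 3) * C) B (k\<^sup>2 * A)"
    have "g' \<circ> ?L = ?h \<circ> ?L"
      unfolding L(2) unfolding Lk g(1)
      using k by (intro even_quadratic_conj_inversion[OF det(1), symmetric]) simp
    then have "g' = ?h" by (rule surj_comp_cancel[OF surj])
    have E: "(- k * D) * (k\<^sup>2 * A) - (- (k ^ 3) * C) * B = - (k ^ 3 * (A * D - B * C))"
      by (simp add: algebra_simps power2_eq_square power3_eq_cube)
    then have "(- k * D) * (k\<^sup>2 * A) - (- (k ^ 3) * C) * B \<noteq> 0" using det k by simp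
    then obtain m where m: "m \<noteq> 0" "- k * D = m * A'" "- (k ^ 3) * C = m * B'" "B = m * C'" "k\<^sup>2 * A = m * D'"
      by (rule even_quadratic_eqD[OF det(2) _ g'(1)[symmetric, THEN trans, OF \<open>g' = ?h\<close>]])
    \<comment> \<open>The determinant of \<open>?h\<close> is positive as a square times that of
      \<open>g'\<close>, but negative by \<open>E\<close>, so this case is contradictory.\<close>
    have "(- k * D) * (k\<^sup>2 * A) - (- (k ^ 3) * C) * B = m\<^sup>2 * (A' * D' - B' * C')"
      unfolding m by (simp add: algebra_simps power2_eq_square)
    moreover have "m\<^sup>2 * (A' * D' - B' * C') > 0" using m g' by simp
    moreover have "k ^ 3 * (A * D - B * C) > 0" using k g by simp
    ultimately show ?thesis using E by linarith
  qed
qed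

lemma even_quadratic_op_conjugate_canonical_form:
  assumes "A * D - B * C \<noteq> 0"
  obtains A' B' C' D' g where "op_conjugate (even_quadratic A B C D) g" "canonical_form A' B' C' D' g"
proof -
  note main = that
  \<comment> \<open>Scaling by \<open>k > 0\<close> multiplies the determinant by \<open>k^3\<close>
    and can restore balance, so it suffices to reach a positive determinant.\<close>
  have pos: thesis if det: "A1 * D1 - B1 * C1 > 0"
    and conj: "op_conjugate (even_quadratic A B C D) (even_quadratic A1 B1 C1 D1)" for A1 B1 C1 D1
  proof -
    have nz: "A1 * D1 - B1 * C1 \<noteq> 0" using det by simp
    obtain k where k: "k > 0" "(k * A1)\<^sup>2 + C1\<^sup>2 = (k ^ 3 * B1)\<^sup>2 + (k\<^sup>2 * D1)\<^sup>2"
      using balanced_scaling_exists[OF nz] .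
    let ?g = "even_quadratic (k * A1) (k ^ 3 * B1) C1 (k\<^sup>2 * D1)"
    have g: "op_conjugate (even_quadratic A1 B1 C1 D1) ?g"
      unfolding op_conjugate_iff
    proof (intro exI conjI)
      show "k * 1 - 0 * 0 > 0" using k by simp
      show "?g \<circ> moebius k 0 0 1 = moebius k 0 0 1 \<circ> even_quadratic A1 B1 C1 D1"
        using k by (intro even_quadratic_conj_scaling[OF nz]) simp
    qed
    have "(k * A1) * (k\<^sup>2 * D1) - (k ^ 3 * B1) * C1 = k ^ 3 * (A1 * D1 - B1 * C1)"
      by (simp add: algebra_simps power2_eq_square power3_eq_cube)
    then have "(k * A1) * (k\<^sup>2 * D1) - (k ^ 3 * B1) * C1 > 0" using k det by simp
    then have "canonical_form (k * A1) (k ^ 3 * B1) C1 (k\<^sup>2 * D1) ?g"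
      unfolding canonical_form_def using k by simp
    then show ?thesis by (rule main[OF op_conjugate_trans[OF conj g]])
  qed
  show ?thesis
  proof (cases "A * D - B * C > 0")
    case True
    have "op_conjugate (even_quadratic A B C D) (even_quadratic A B C D)"
      unfolding op_conjugate_iff
    proof (intro exI conjI)
      show "1 * 1 - 0 * 0 > (0::real)" by simp
    qed (simp only: moebius_scalar[OF one_neq_zero] comp_id id_comp)
    then show ?thesis by (rule pos[OF True])
  next
    case False
    \<comment> \<open>Conjugation by \<open>x -> -1/x\<close> reverses the sign of the determinant;
      the coefficients are left in the unsimplified form of the inversion lemma at
      \<open>k = 1\<close>.\<close>
    have conj: "op_conjugate (even_quadratic A B C D) (even_quadratic (- 1 * D) (- (1 ^ 3) * C) B (1\<^sup>2 * A))"
      unfolding op_conjugate_iff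
    proof (intro exI conjI)
      show "0 * 0 - (- 1) * 1 > (0::real)" by simp
    qed (rule even_quadratic_conj_inversion[OF assms one_neq_zero])
    have "(- 1 * D) * (1\<^sup>2 * A) - (- (1 ^ 3) * C) * B > 0"
      using False assms by (simp add: algebra_simps)
    then show ?thesis by (rule pos[OF _ conj])
  qed
qed

section \<open>The Wronskian\<close>

text \<open>The Wronskian is the numerator of the derivative of \<open>P / Q\<close>. Near
  \<open>z\<close> the denominator stays nonzero, so there the chart expression is an ordinary
  difference of quotients. The lemma serves to turn a non-real zero of the Wronskian into a
  forbidden critical point.\<close>

lemma critical_point_of_wronskian_zero:
  fixes p q :: "real poly" and z :: complex
  defines "P \<equiv> map_poly complex_of_real p" and "Q \<equiv> map_poly complex_of_real q"
  assumes Q: "poly Q z \<noteq> 0"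
    and W: "poly (pderiv P) z * poly Q z = poly P z * poly (pderiv Q) z"
  shows "critical_point (rat_map p q) (Some z)"
proof -
  let ?h = "\<lambda>t. poly P (z + t) / poly Q (z + t) - poly P z / poly Q z"
  have f: "rat_map p q (Some w) = (if poly Q w = 0 then None else Some (poly P w / poly Q w))" for w
    by (simp add: rat_map_def P_def Q_def Let_def)
  have "((\<lambda>t. poly Q (z + t)) \<longlongrightarrow> poly Q (z + 0)) (at 0)"
    by (intro tendsto_intros)
  then have "eventually (\<lambda>t. poly Q (z + t) \<noteq> 0) (at 0)"
    using Q by (intro tendsto_imp_eventually_ne) auto
  then have ev: "eventually (\<lambda>t. ?h t = chart (rat_map p q (Some z)) (rat_map p q (chart_inv (Some z) t))) (at 0)"
    by eventually_elim (use Q in \<open>simp add: f\<close>)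
  have "(?h has_field_derivative 0) (at 0)"
    using Q W by (auto intro!: derivative_eq_intros)
  then have "((\<lambda>t. chart (rat_map p q (Some z)) (rat_map p q (chart_inv (Some z) t))) has_field_derivative 0) (at 0)"
    by (subst (asm) has_field_derivative_cong_eventually[OF ev]) (use Q in \<open>simp_all add: f\<close>)
  then show ?thesis unfolding critical_point_def .
qed


section \<open>Real quadratic polynomials and coprimality\<close>

lemma poly_of_degree_le_2:
  assumes "degree p \<le> 2"
  shows "p = [:coeff p 0, coeff p 1, coeff p 2:]"
proof (rule poly_eqI)
  fix n :: nat
  consider "n = 0" | "n = 1" | "n = 2" | "n > 2" by linarith
  then show "coeff p n = coeff [:coeff p 0, coeff p 1, coeff p 2:] n"
  proof cases
    case 4
    then have "coeff p n = 0" using assms by (intro coeff_eq_0) simp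
    with 4 show ?thesis by (auto simp: coeff_pCons split: nat.split)
  qed (simp_all add: numeral_2_eq_2)
qed

lemma real_rational_map_2E:
  assumes "real_rational_map 2 f"
  obtains p0 p1 p2 q0 q1 q2 where "coprime [:p0, p1, p2:] [:q0, q1, q2:]" "p2 \<noteq> 0 \<or> q2 \<noteq> 0"
    "f = rat_map [:p0, p1, p2:] [:q0, q1, q2:]"
proof -
  obtain p q where pq: "coprime p q" "max (degree p) (degree q) = 2" "f = rat_map p q"
    using assms by (auto simp: real_rational_map_def)
  then have "degree p \<le> 2" "degree q \<le> 2" by auto
  note eq = this[THEN poly_of_degree_le_2]
  have "degree p = 2 \<or> degree q = 2" using pq(2) by (auto simp: max_def split: if_splits)
  then have "coeff p 2 \<noteq> 0 \<or> coeff q 2 \<noteq> 0"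
  proof
    assume d: "degree p = 2"
    then have "p \<noteq> 0" by auto
    then show ?thesis using leading_coeff_0_iff[of p] unfolding d by blast
  next
    assume d: "degree q = 2"
    then have "q \<noteq> 0" by auto
    then show ?thesis using leading_coeff_0_iff[of q] unfolding d by blast
  qed
  then show ?thesis
    by (rule that[of "coeff p 0" "coeff p 1" "coeff p 2" "coeff q 0" "coeff q 1" "coeff q 2",
          folded eq, OF pq(1) _ pq(3)])
qed

lemma coprime_no_common_root:
  fixes p q :: "real poly"
  assumes "coprime p q" "poly p r = 0" "poly q r = 0"
  shows False
proof -
  have "[:- r, 1:] dvd 1"
    using assms(2,3) by (intro coprime_common_divisor[OF assms(1)]) (simp_all only: poly_eq_0_iff_dvd)
  then have "degree [:- r, 1:] = 0"
    by (subst (asm) is_unit_iff_degree) simp_all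
  then show False by simp
qed

lemma coprime_smult_eq_degree_0:
  fixes p q :: "real poly"
  assumes "coprime p q" "smult a p = smult b q" "a \<noteq> 0"
  shows "degree q = 0"
proof -
  have "q dvd smult a p" unfolding assms(2) by (rule dvd_smult[OF dvd_refl])
  then have "q dvd p" by (rule dvd_smult_cancel[OF _ assms(3)])
  then have "q dvd 1" by (rule coprime_common_divisor[OF assms(1) _ dvd_refl])
  then show ?thesis using is_unit_iff_degree[of q] by fastforce
qed

section \<open>Moving the zeros of the Wronskian to infinity and 0\<close>

text \<open>For the quadratics \<open>p\<close> and \<open>q\<close> with these coefficients,
  \<open>p' q - p q'\<close> equals \<open>\<alpha> x^2 + 2 \<beta> x + \<gamma>\<close>, so
  \<open>\<beta>^2 - \<alpha> \<gamma>\<close> is a quarter of its discriminant.\<close>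

context
  fixes p0 p1 p2 q0 q1 q2 \<alpha> \<beta> \<gamma> :: real
  assumes wronskian: "\<alpha> = p2 * q1 - p1 * q2" "\<beta> = p2 * q0 - p0 * q2" "\<gamma> = p1 * q0 - p0 * q1"
begin

text \<open>
  Apolarity to the Wronskian form makes the mixed coefficients of \<open>p\<close> and \<open>q\<close> vanish
  in the basis given by its two roots.
\<close>

lemma wronskian_apolar: "p2 * \<gamma> - p1 * \<beta> + p0 * \<alpha> = 0" "q2 * \<gamma> - q1 * \<beta> + q0 * \<alpha> = 0"
  unfolding wronskian by (simp_all add: algebra_simps)

text \<open>At a finite double root \<open>r\<close>, apolarity reads
  \<open>\<alpha> p(r) = \<alpha> q(r) = 0\<close>, a common root of coprime polynomials. A double
  root at infinity means \<open>\<alpha> = \<beta> = 0\<close>; then \<open>q2 p = p2 q\<close>,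
  which coprimality allows only for constants.\<close>

lemma wronskian_discriminant_nonzero:
  assumes coprime: "coprime [:p0, p1, p2:] [:q0, q1, q2:]" and deg: "p2 \<noteq> 0 \<or> q2 \<noteq> 0"
  shows "\<beta>\<^sup>2 - \<alpha> * \<gamma> \<noteq> 0"
proof
  assume disc: "\<beta>\<^sup>2 - \<alpha> * \<gamma> = 0"
  show False
  proof (cases "\<alpha> = 0")
    case False
    define r where "r = - \<beta> / \<alpha>"
    have \<beta>: "\<beta> = - (\<alpha> * r)" using False by (simp add: r_def)
    then have "\<alpha> * (\<alpha> * r\<^sup>2) = \<alpha> * \<gamma>" using disc by (simp add: power2_eq_square algebra_simps)
    then have \<gamma>: "\<gamma> = \<alpha> * r\<^sup>2" using False by simp
    have "\<alpha> * (p0 + r * (p1 + r * p2)) = 0" "\<alpha> * (q0 + r * (q1 + r * q2)) = 0"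
      using wronskian_apolar unfolding \<beta> \<gamma> by (simp_all add: power2_eq_square algebra_simps)
    then show False using coprime_no_common_root[OF coprime, of r] False by simp
  next
    case True
    then have eq: "smult q2 [:p0, p1, p2:] = smult p2 [:q0, q1, q2:]"
      using disc wronskian by (simp add: algebra_simps)
    show False
    proof (cases "q2 = 0")
      case True
      then show False
        using coprime_smult_eq_degree_0[OF _ eq[symmetric]] coprime deg by (simp add: coprime_commute)
    next
      case False
      then show False using coprime_smult_eq_degree_0[OF coprime eq] by simp
    qed
  qed
qed

lemma wronskian_discriminant_nonneg:
  assumes crit: "\<And>w. critical_point (rat_map [:p0, p1, p2:] [:q0, q1, q2:]) w \<Longrightarrow> w \<in> extended_reals"
  shows "\<beta>\<^sup>2 - \<alpha> * \<gamma> \<ge> 0"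
proof (rule ccontr)
  assume "\<not> ?thesis"
  then have neg: "\<alpha> * \<gamma> - \<beta>\<^sup>2 > 0" by simp
  then have \<alpha>: "\<alpha> \<noteq> 0" by (auto simp: not_less)
  define s where "s = sqrt (\<alpha> * \<gamma> - \<beta>\<^sup>2)"
  have s: "s \<noteq> 0" "s\<^sup>2 = \<alpha> * \<gamma> - \<beta>\<^sup>2" using neg by (simp_all add: s_def)
  define z where "z = Complex (- \<beta> / \<alpha>) (s / \<alpha>)"
  have Im: "Im z \<noteq> 0" using s \<alpha> by (simp add: z_def)
  \<comment> \<open>\<open>z\<close> is a root obtained by completing the square in the
    Wronskian.\<close>
  have lin: "\<alpha> * z + \<beta> = \<i> * s" using \<alpha> by (simp add: z_def complex_eq_iff)
  have "\<alpha> * (\<alpha> * z\<^sup>2 + 2 * \<beta> * z + \<gamma>) = (\<alpha> * z + \<beta>)\<^sup>2 + of_real (\<alpha> * \<gamma> - \<beta>\<^sup>2)"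
    by (simp add: power2_eq_square algebra_simps)
  also have "\<dots> = 0" unfolding lin s(2)[symmetric] by (simp add: power_mult_distrib)
  finally have root: "\<alpha> * z\<^sup>2 + 2 * \<beta> * z + \<gamma> = 0" using \<alpha> by simp
  define P Q P' Q' where PQ: "P = p0 + z * (p1 + z * p2)" "Q = q0 + z * (q1 + z * q2)"
    "P' = p1 + z * (2 * p2)" "Q' = q1 + z * (2 * q2)"
  have "P' * Q - P * Q' = \<alpha> * z\<^sup>2 + 2 * \<beta> * z + \<gamma>"
    unfolding PQ wronskian by (simp add: power2_eq_square algebra_simps)
  then have W: "P' * Q = P * Q'" using root by simp
  \<comment> \<open>A pole at \<open>z\<close> would satisfy \<open>P \<noteq> 0\<close>, hence
    \<open>Q' = 0\<close> by \<open>W\<close>. But \<open>Q'\<close> is a real linear polynomial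
    with leading coefficient \<open>2 * q2\<close>, nonzero here, and has no non-real root.\<close>
  have "Q \<noteq> 0"
  proof
    assume "Q = 0"
    have "q2 * P - p2 * Q = - (\<alpha> * z + \<beta>)"
      unfolding PQ wronskian by (simp add: power2_eq_square algebra_simps)
    then have "q2 * P \<noteq> 0" using \<open>Q = 0\<close> lin s by simp
    then have "q2 \<noteq> 0" "Q' = 0" using W \<open>Q = 0\<close> by auto
    then show False using Im unfolding PQ by (simp add: complex_eq_iff)
  qed
  then have "critical_point (rat_map [:p0, p1, p2:] [:q0, q1, q2:]) (Some z)"
    using W unfolding PQ
    by (intro critical_point_of_wronskian_zero)
      (simp_all add: map_poly_pCons pderiv_pCons algebra_simps)
  then have "z \<in> \<real>" using crit by (auto simp: extended_reals_def)
  then show False using Im by (simp add: complex_is_Real_iff)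
qed

text \<open>The roots are \<open>[u1 : v1]\<close> and \<open>[u2 : v2]\<close>, possibly infinite.
  The three equations are Vieta's: \<open>(v1 x - u1) (v2 x - u2)\<close> is \<open>\<kappa>\<close>
  times the Wronskian.\<close>

lemma real_wronskian_roots:
  assumes "\<beta>\<^sup>2 - \<alpha> * \<gamma> > 0"
  obtains u1 v1 u2 v2 \<kappa> where "\<kappa> \<noteq> 0" "u1 * v2 - u2 * v1 > 0"
    "v1 * v2 = \<kappa> * \<alpha>" "u1 * v2 + u2 * v1 = - 2 * \<kappa> * \<beta>" "u1 * u2 = \<kappa> * \<gamma>"
proof -
  have "\<exists>u1 v1 u2 v2 \<kappa>. \<kappa> \<noteq> 0 \<and> u1 * v2 - u2 * v1 \<noteq> 0 \<and>
    v1 * v2 = \<kappa> * \<alpha> \<and> u1 * v2 + u2 * v1 = - 2 * \<kappa> * \<beta> \<and> u1 * u2 = \<kappa> * \<gamma>"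
  proof (cases "\<alpha> = 0")
    case True
    \<comment> \<open>One root is infinity, the other
      \<open>-\<gamma> / (2 \<beta>)\<close>.\<close>
    then show ?thesis using assms
      by (intro exI[of _ 1] exI[of _ 0] exI[of _ "- \<gamma>"] exI[of _ "2 * \<beta>"] exI[of _ "- 1"]) auto
  next
    case False
    define s where "s = sqrt (\<beta>\<^sup>2 - \<alpha> * \<gamma>)"
    have s: "s \<noteq> 0" "s * s = \<beta>\<^sup>2 - \<alpha> * \<gamma>" using assms by (simp_all add: s_def)
    show ?thesis using False s
      by (intro exI[of _ "- \<beta> + s"] exI[of _ \<alpha>] exI[of _ "- \<beta> - s"] exI[of _ \<alpha>] exI[of _ \<alpha>])
        (simp add: algebra_simps power2_eq_square)
  qed
  then obtain u1 v1 u2 v2 \<kappa> where *: "\<kappa> \<noteq> 0" "u1 * v2 - u2 * v1 \<noteq> 0"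
    "v1 * v2 = \<kappa> * \<alpha>" "u1 * v2 + u2 * v1 = - 2 * \<kappa> * \<beta>" "u1 * u2 = \<kappa> * \<gamma>"
    by blast
  show ?thesis
  proof (cases "u1 * v2 - u2 * v1 > 0")
    case True
    then show ?thesis using that * by blast
  next
    case False
    \<comment> \<open>Negating the representative \<open>(u1, v1)\<close> keeps the root, reverses
      the determinant and changes the sign of \<open>\<kappa>\<close>.\<close>
    then show ?thesis using that[of "- \<kappa>" "- u1" v2 u2 "- v1"] * by simp
  qed
qed

text \<open>The matrix with columns \<open>(u1, v1)\<close> and \<open>(u2, v2)\<close> sends
  infinity and 0 to the two roots. In these coordinates the mixed terms of \<open>p\<close> and
  \<open>q\<close> vanish by apolarity, so the conjugated map is even.\<close>

lemma op_conjugate_even_quadratic: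
  assumes deg: "p2 \<noteq> 0 \<or> q2 \<noteq> 0" and disc: "\<beta>\<^sup>2 - \<alpha> * \<gamma> > 0"
  obtains A B C D where "A * D - B * C \<noteq> 0"
    "op_conjugate (rat_map [:p0, p1, p2:] [:q0, q1, q2:]) (even_quadratic A B C D)"
proof -
  obtain u1 v1 u2 v2 \<kappa> where \<kappa>: "\<kappa> \<noteq> 0" and det: "u1 * v2 - u2 * v1 > 0" and
    e: "v1 * v2 = \<kappa> * \<alpha>" "u1 * v2 + u2 * v1 = - 2 * \<kappa> * \<beta>" "u1 * u2 = \<kappa> * \<gamma>"
    using real_wronskian_roots[OF disc] .
  define \<delta> where "\<delta> = u1 * v2 - u2 * v1"
  have \<delta>: "\<delta> > 0" using det by (simp add: \<delta>_def)
  define P2 Q2 P0 Q0 where PQ: "P2 = p2 * u1\<^sup>2 + p1 * u1 * v1 + p0 * v1\<^sup>2"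
    "Q2 = q2 * u1\<^sup>2 + q1 * u1 * v1 + q0 * v1\<^sup>2"
    "P0 = p2 * u2\<^sup>2 + p1 * u2 * v2 + p0 * v2\<^sup>2"
    "Q0 = q2 * u2\<^sup>2 + q1 * u2 * v2 + q0 * v2\<^sup>2"
  \<comment> \<open>The bracket is the polar form of the Wronskian at its two roots, which Vieta's
    relations turn into a multiple of the discriminant.\<close>
  have "P2 * Q0 - P0 * Q2 = \<delta> * (\<alpha> * (u1 * u2) + \<beta> * (u1 * v2 + u2 * v1) + \<gamma> * (v1 * v2))"
    unfolding PQ \<delta>_def wronskian by (simp add: algebra_simps power2_eq_square)
  also have "\<dots> = - 2 * \<delta> * \<kappa> * (\<beta>\<^sup>2 - \<alpha> * \<gamma>)"
    unfolding e by (simp add: algebra_simps power2_eq_square)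
  finally have PQdet: "P2 * Q0 - P0 * Q2 \<noteq> 0" using \<delta> \<kappa> disc by simp
  have mixed: "2 * p2 * (u1 * u2) + p1 * (u1 * v2 + u2 * v1) + 2 * p0 * (v1 * v2) = 0"
    "2 * q2 * (u1 * u2) + q1 * (u1 * v2 + u2 * v1) + 2 * q0 * (v1 * v2) = 0"
  proof -
    have "2 * p2 * (\<kappa> * \<gamma>) + p1 * (- 2 * \<kappa> * \<beta>) + 2 * p0 * (\<kappa> * \<alpha>) =
        2 * \<kappa> * (p2 * \<gamma> - p1 * \<beta> + p0 * \<alpha>)"
      "2 * q2 * (\<kappa> * \<gamma>) + q1 * (- 2 * \<kappa> * \<beta>) + 2 * q0 * (\<kappa> * \<alpha>) =
        2 * \<kappa> * (q2 * \<gamma> - q1 * \<beta> + q0 * \<alpha>)"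
      by (simp_all add: algebra_simps)
    then show "2 * p2 * (u1 * u2) + p1 * (u1 * v2 + u2 * v1) + 2 * p0 * (v1 * v2) = 0"
      "2 * q2 * (u1 * u2) + q1 * (u1 * v2 + u2 * v1) + 2 * q0 * (v1 * v2) = 0"
      unfolding e wronskian_apolar by simp_all
  qed
  \<comment> \<open>The adjugate of the coordinate matrix applied to \<open>(P2, Q2)\<close> and
    \<open>(P0, Q0)\<close>, that is, the inverse change of coordinates up to the factor
    \<open>\<delta>\<close>.\<close>
  define A B C D where ABCD: "A = v2 * P2 - u2 * Q2" "B = v2 * P0 - u2 * Q0"
    "C = u1 * Q2 - v1 * P2" "D = u1 * Q0 - v1 * P0"
  have "A * D - B * C = \<delta> * (P2 * Q0 - P0 * Q2)"
    unfolding ABCD \<delta>_def by (simp add: algebra_simps)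
  then have ADBC: "A * D - B * C \<noteq> 0" using \<delta> PQdet by simp
  let ?f = "rat_map [:p0, p1, p2:] [:q0, q1, q2:]"
  have N: "u1 * v2 - u2 * v1 \<noteq> 0" using det by simp
  have "?f \<circ> moebius u1 u2 v1 v2 = moebius u1 u2 v1 v2 \<circ> even_quadratic A B C D"
  proof
    fix w
    obtain x y where w: "x \<noteq> 0 \<or> y \<noteq> 0" "w = proj_point x y"
      by (rule proj_point_cases)
    have restrict: "a * (u1 * x + u2 * y)\<^sup>2 + b * (u1 * x + u2 * y) * (v1 * x + v2 * y) + c * (v1 * x + v2 * y)\<^sup>2
      = of_real (a * u1\<^sup>2 + b * u1 * v1 + c * v1\<^sup>2) * x\<^sup>2 + of_real (a * u2\<^sup>2 + b * u2 * v2 + c * v2\<^sup>2) * y\<^sup>2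
       + of_real (2 * a * (u1 * u2) + b * (u1 * v2 + u2 * v1) + 2 * c * (v1 * v2)) * x * y" for a b c :: real
      by (simp add: algebra_simps power2_eq_square)
    have "(?f \<circ> moebius u1 u2 v1 v2) w = proj_point (P2 * x\<^sup>2 + P0 * y\<^sup>2) (Q2 * x\<^sup>2 + Q0 * y\<^sup>2)"
      unfolding w o_apply moebius_proj_point[OF N w(1)]
        quadratic_proj_point[OF deg linear_pair_nonzero[OF N w(1)]] restrict mixed PQ
      by simp
    also have "\<dots> = proj_point (\<delta> * (P2 * x\<^sup>2 + P0 * y\<^sup>2)) (\<delta> * (Q2 * x\<^sup>2 + Q0 * y\<^sup>2))"
      using \<delta> by (simp add: proj_point_def del: distrib_left_numeral)
    also have "\<dots> = proj_point (u1 * (A * x\<^sup>2 + B * y\<^sup>2) + u2 * (C * x\<^sup>2 + D * y\<^sup>2))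
        (v1 * (A * x\<^sup>2 + B * y\<^sup>2) + v2 * (C * x\<^sup>2 + D * y\<^sup>2))"
      unfolding ABCD \<delta>_def by (simp add: algebra_simps)
    also have "\<dots> = (moebius u1 u2 v1 v2 \<circ> even_quadratic A B C D) w"
      unfolding w o_apply even_quadratic_proj_point[OF ADBC w(1)]
        moebius_proj_point[OF N even_quadratic_pair_nonzero[OF ADBC w(1)]] ..
    finally show "(?f \<circ> moebius u1 u2 v1 v2) w = (moebius u1 u2 v1 v2 \<circ> even_quadratic A B C D) w" .
  qed
  then have "op_conjugate (even_quadratic A B C D) ?f"
    unfolding op_conjugate_iff using det by blast
  then show ?thesis using that ADBC op_conjugate_sym by blast
qed

end

section \<open>Uniqueness of the coefficients, and the theorem\<close>

text \<open>The map determines its coefficients up to a factor. Conversely, balance is homogeneous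
  and the determinant is multiplied by \<open>k^2 > 0\<close>, so either sign of \<open>k\<close> is
  allowed.\<close>

lemma canonical_form_coefficients:
  assumes "canonical_form A B C D g"
  shows "canonical_form A' B' C' D' g \<longleftrightarrow>
    (\<exists>k. k \<noteq> 0 \<and> A' = k * A \<and> B' = k * B \<and> C' = k * C \<and> D' = k * D)"
proof
  assume "canonical_form A' B' C' D' g"
  with assms have "even_quadratic A B C D = even_quadratic A' B' C' D'"
    "A * D - B * C \<noteq> 0" "A' * D' - B' * C' \<noteq> 0"
    by (auto simp: canonical_form_def)
  then show "\<exists>k. k \<noteq> 0 \<and> A' = k * A \<and> B' = k * B \<and> C' = k * C \<and> D' = k * D"
    using even_quadratic_eqD by metis
next
  assume "\<exists>k. k \<noteq> 0 \<and> A' = k * A \<and> B' = k * B \<and> C' = k * C \<and> D' = k * D"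
  then obtain k where k: "k \<noteq> 0" "A' = k * A" "B' = k * B" "C' = k * C" "D' = k * D" by blast
  have g: "g = even_quadratic A B C D" "A\<^sup>2 + C\<^sup>2 = B\<^sup>2 + D\<^sup>2" "A * D - B * C > 0"
    using assms by (auto simp: canonical_form_def)
  have "A'\<^sup>2 + C'\<^sup>2 = B'\<^sup>2 + D'\<^sup>2"
    unfolding k power_mult_distrib distrib_left[symmetric] g(2) ..
  moreover have "A' * D' - B' * C' = k\<^sup>2 * (A * D - B * C)"
    unfolding k by (simp add: algebra_simps power2_eq_square)
  then have "A' * D' - B' * C' > 0" using k(1) g(3) by simp
  moreover have "even_quadratic A' B' C' D' = g"
    unfolding k g(1) using k(1) g(3) by (intro even_quadratic_scale) auto
  ultimately show "canonical_form A' B' C' D' g"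
    by (simp add: canonical_form_def)
qed

theorem theorem6p1:
  fixes f :: "sphere \<Rightarrow> sphere"
  assumes "real_rational_map 2 f"
    and "\<And>w. critical_point f w \<Longrightarrow> w \<in> extended_reals"
  shows "(\<exists>!g. op_conjugate f g \<and> (\<exists>A B C D. canonical_form A B C D g)) \<and>
    (\<forall>g A B C D A' B' C' D'.
      op_conjugate f g \<and> canonical_form A B C D g \<longrightarrow>
      (canonical_form A' B' C' D' g \<longleftrightarrow>
        (\<exists>k. k \<noteq> 0 \<and> A' = k * A \<and> B' = k * B \<and> C' = k * C \<and> D' = k * D)))"
proof (intro conjI ex_ex1I)
  obtain p0 p1 p2 q0 q1 q2 where pq: "coprime [:p0, p1, p2:] [:q0, q1, q2:]" "p2 \<noteq> 0 \<or> q2 \<noteq> 0"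
    and f: "f = rat_map [:p0, p1, p2:] [:q0, q1, q2:]"
    using real_rational_map_2E[OF assms(1)] .
  have "(p2 * q0 - p0 * q2)\<^sup>2 - (p2 * q1 - p1 * q2) * (p1 * q0 - p0 * q1) > 0"
    (is "?disc > 0")
  proof -
    \<comment> \<open>Real critical points exclude a negative discriminant, and coprimality excludes
      a double root.\<close>
    have "?disc \<ge> 0"
      by (rule wronskian_discriminant_nonneg[OF refl refl refl]) (rule assms(2)[unfolded f])
    moreover have "?disc \<noteq> 0"
      by (rule wronskian_discriminant_nonzero[OF refl refl refl pq])
    ultimately show ?thesis by linarith
  qed
  then obtain A B C D where "A * D - B * C \<noteq> 0" "op_conjugate f (even_quadratic A B C D)"
    unfolding f using op_conjugate_even_quadratic[OF refl refl refl pq(2)] by blast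
  then show "\<exists>g. op_conjugate f g \<and> (\<exists>A B C D. canonical_form A B C D g)"
    using even_quadratic_op_conjugate_canonical_form op_conjugate_trans by metis
next
  fix g g'
  assume "op_conjugate f g \<and> (\<exists>A B C D. canonical_form A B C D g)"
    "op_conjugate f g' \<and> (\<exists>A B C D. canonical_form A B C D g')"
  then show "g = g'"
    using op_conjugate_canonical_form_unique op_conjugate_sym op_conjugate_trans by blast
next
  show "\<forall>g A B C D A' B' C' D'.
      op_conjugate f g \<and> canonical_form A B C D g \<longrightarrow>
      (canonical_form A' B' C' D' g \<longleftrightarrow>
        (\<exists>k. k \<noteq> 0 \<and> A' = k * A \<and> B' = k * B \<and> C' = k * C \<and> D' = k * D))"
    using canonical_form_coefficients by blast
qed

end
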